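(* Let $p$ be a prime and $w\ge1$ an integer. Let $j_0\in\{0,\ldots,p-1\}$ with $j_0\equiv\frac12(w-1)p(p+1)\pmod p$, and $$\mathcal E_{j_0}=\Big\{(k_1,\ldots,k_p)\in\mathbb N^p:\ \sum_{i=1}^p k_i=pw-(p-1),\ \sum_{i=1}^p ik_i\equiv j_0\pmod p\Big\}.$$ For $\underline k\in\mathcal E_{j_0}$ set $c_{\underline k,0}=\frac1p\Big(\frac{(w-1)p(p+1)}2-\sum_{i=1}^p ik_i\Big)+1$ and, for $1\le j\le p-1$, $c_{\underline k,j}=c_{\underline k,0}+j(w-1)-\sum_{i=1}^j k_i$. Then $\{(c_{\underline k,0},\ldots,c_{\underline k,p-1}):\underline k\in\mathcal E_{j_0}\}$ is exactly the set of ancestors for $p$ and $w$, and it parametrizes the Scopes families (each Scopes family contains exactly one of these vectors).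
   Context: $\mathbb N=\{0,1,2,\ldots\}$. Fix a prime $p$ and $w\ge1$. Let $\mathscr C_p=\{(c_0,\ldots,c_{p-1})\in\mathbb Z^p:\sum c_j=0\}$. For $1\le j\le p-1$, $c\in\mathscr C_p$ is $j$-allowed if $c_j-c_{j-1}\ge w$, and then $\mathrm{sc}_j(c)$ is $c$ with the coordinates $c_{j-1}$ and $c_j$ interchanged. $c$ is $0$-allowed if $c_0-c_{p-1}>w$, and then $\mathrm{sc}_0(c)=(c_{p-1}+1,c_1,\ldots,c_{p-2},c_0-1)$. $c$ is allowed if it is $j$-allowed for some $j$, and an ancestor if it is not allowed. The Scopes families are the equivalence classes of the equivalence relation on $\mathscr C_p$ generated by $c\sim\mathrm{sc}_j(c)$ for all $j$ and all $j$-allowed $c$. *)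

theory Defs
  imports "HOL-Library.FuncSet" "HOL-Number_Theory.Number_Theory"
begin

text \<open>Vectors are extensional functions on their index set, so that equality of functions is
  equality of vectors and the indices \<open>0, \<dots>, p - 1\<close> resp. \<open>1, \<dots>, p\<close> can be used literally.\<close>

definition core_vectors :: "nat \<Rightarrow> (nat \<Rightarrow> int) set" where
  "core_vectors p = {c \<in> {0..<p} \<rightarrow>\<^sub>E UNIV. (\<Sum>j = 0..<p. c j) = 0}"

definition j_allowed :: "nat \<Rightarrow> nat \<Rightarrow> nat \<Rightarrow> (nat \<Rightarrow> int) \<Rightarrow> bool" where
  "j_allowed p w j c \<longleftrightarrow>
     (if j = 0 then c 0 - c (p - 1) > int w else c j - c (j - 1) \<ge> int w)"

definition sc :: "nat \<Rightarrow> nat \<Rightarrow> (nat \<Rightarrow> int) \<Rightarrow> nat \<Rightarrow> int" where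
  "sc p j c =
     (if j = 0 then c(0 := c (p - 1) + 1, p - 1 := c 0 - 1)
      else c(j - 1 := c j, j := c (j - 1)))"

definition allowed :: "nat \<Rightarrow> nat \<Rightarrow> (nat \<Rightarrow> int) \<Rightarrow> bool" where
  "allowed p w c \<longleftrightarrow> (\<exists>j\<in>{0..<p}. j_allowed p w j c)"

definition ancestors :: "nat \<Rightarrow> nat \<Rightarrow> (nat \<Rightarrow> int) set" where
  "ancestors p w = {c \<in> core_vectors p. \<not> allowed p w c}"

definition scopes_step :: "nat \<Rightarrow> nat \<Rightarrow> (nat \<Rightarrow> int) \<Rightarrow> (nat \<Rightarrow> int) \<Rightarrow> bool" where
  "scopes_step p w c d \<longleftrightarrow>
     c \<in> core_vectors p \<and> (\<exists>j\<in>{0..<p}. j_allowed p w j c \<and> d = sc p j c)"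

definition scopes_rel :: "nat \<Rightarrow> nat \<Rightarrow> ((nat \<Rightarrow> int) \<times> (nat \<Rightarrow> int)) set" where
  "scopes_rel p w =
     {(c, d). c \<in> core_vectors p \<and> d \<in> core_vectors p \<and> equivclp (scopes_step p w) c d}"

definition scopes_families :: "nat \<Rightarrow> nat \<Rightarrow> (nat \<Rightarrow> int) set set" where
  "scopes_families p w = core_vectors p // scopes_rel p w"

definition E_set :: "nat \<Rightarrow> nat \<Rightarrow> nat \<Rightarrow> (nat \<Rightarrow> nat) set" where
  "E_set p w j0 =
     {k \<in> {1..p} \<rightarrow>\<^sub>E UNIV.
        int (\<Sum>i = 1..p. k i) = int p * int w - (int p - 1) \<and>
        [(\<Sum>i = 1..p. i * k i) = j0] (mod p)}"

text \<open>The integer divisions below are exact: \<open>p (p + 1)\<close> is even, and for the divisor \<open>p\<close>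
  see \<open>c0_division_exact\<close>.\<close>

definition c0_of :: "nat \<Rightarrow> nat \<Rightarrow> (nat \<Rightarrow> nat) \<Rightarrow> int" where
  "c0_of p w k =
     ((int w - 1) * int p * (int p + 1) div 2 - int (\<Sum>i = 1..p. i * k i)) div int p + 1"

text \<open>For \<open>j = 0\<close> the formula reduces to \<open>c0_of p w k\<close>.\<close>

definition c_of :: "nat \<Rightarrow> nat \<Rightarrow> (nat \<Rightarrow> nat) \<Rightarrow> nat \<Rightarrow> int" where
  "c_of p w k =
     (\<lambda>j\<in>{0..<p}. c0_of p w k + int j * (int w - 1) - int (\<Sum>i = 1..j. k i))"

lemma c0_division_exact:
  assumes "[int j0 = (int w - 1) * int p * (int p + 1) div 2] (mod int p)"
    and "k \<in> E_set p w j0"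
  shows "int p dvd (int w - 1) * int p * (int p + 1) div 2 - int (\<Sum>i = 1..p. i * k i)"
proof -
  have "[(\<Sum>i = 1..p. i * k i) = j0] (mod p)"
    using assms(2) by (simp add: E_set_def)
  then have "[int (\<Sum>i = 1..p. i * k i) = int j0] (mod int p)"
    by (simp only: cong_int_iff)
  then have "[(int w - 1) * int p * (int p + 1) div 2 = int (\<Sum>i = 1..p. i * k i)] (mod int p)"
    using assms(1) cong_sym cong_trans by blast
  then show ?thesis
    by (simp only: cong_iff_dvd_diff)
qed

lemma sc_in_core_vectors:
  assumes "2 \<le> p" "c \<in> core_vectors p" "j < p"
  shows "sc p j c \<in> core_vectors p"
proof -
  have two: "(\<Sum>i = 0..<p. (c(a := x, b := y)) i) = (\<Sum>i = 0..<p. c i) - c a - c b + x + y"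
    if "a < p" "b < p" "a \<noteq> b" for a b x y
  proof -
    have split: "(\<Sum>i = 0..<p. f i) = f a + (f b + (\<Sum>i \<in> {0..<p} - {a} - {b}. f i))"
      for f :: "nat \<Rightarrow> int"
      using that by (simp add: sum.remove[of "{0..<p}" a] sum.remove[of "{0..<p} - {a}" b])
    have "(\<Sum>i \<in> {0..<p} - {a} - {b}. (c(a := x, b := y)) i) = (\<Sum>i \<in> {0..<p} - {a} - {b}. c i)"
      by (rule sum.cong) auto
    then show ?thesis
      using that split[of c] split[of "c(a := x, b := y)"] by simp
  qed
  have "sc p j c \<in> {0..<p} \<rightarrow>\<^sub>E UNIV"
    using assms by (auto simp: sc_def core_vectors_def PiE_iff extensional_def)
  moreover have "(\<Sum>i = 0..<p. sc p j c i) = 0"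
    using assms two[of 0 "p - 1" "c (p - 1) + 1" "c 0 - 1"] two[of "j - 1" j "c j" "c (j - 1)"]
    by (cases "j = 0") (auto simp: sc_def core_vectors_def)
  ultimately show ?thesis
    by (simp add: core_vectors_def)
qed

lemma equiv_scopes_rel: "equiv (core_vectors p) (scopes_rel p w)"
  by (rule equivI)
    (auto simp: scopes_rel_def refl_on_def intro!: symI transI
      intro: equivclp_sym equivclp_trans)

end

theory Submission
  imports Defs "HOL-Library.Confluence"
begin

text \<open>
  Ancestors: \<open>c\<close> is an ancestor iff the slacks \<open>k\<^sub>i = w - 1 - (c\<^sub>i - c\<^sub>i\<^sub>-\<^sub>1)\<close> for \<open>0 < i < p\<close> and
  \<open>k\<^sub>p = w - (c\<^sub>0 - c\<^sub>p\<^sub>-\<^sub>1)\<close> are nonnegative. Summation by parts turns \<open>\<Sum> c\<^sub>j = 0\<close> into the formula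
  for \<open>c\<^sub>0\<close>, whose integrality is the congruence condition.

  Families: every Scopes step lowers the energy \<open>p \<Sum> c\<^sub>j\<^sup>2 + 2 \<Sum> j c\<^sub>j\<close>, which is bounded below.
  Extending \<open>c\<close> to all integers by \<open>c\<^sub>i\<^sub>+\<^sub>p = c\<^sub>i - 1\<close>, a step at \<open>j\<close> is the interchange of
  \<open>c\<^sub>j\<^sub>-\<^sub>1\<close> and \<open>c\<^sub>j\<close> when \<open>c\<^sub>j - c\<^sub>j\<^sub>-\<^sub>1 \<ge> w\<close>, also for \<open>j = 0\<close>. Two such steps commute if they are
  not adjacent and otherwise complete to a braid relation, so steps are locally confluent; Newman's
  lemma gives a unique normal form in each class, and normal forms are the ancestors.
\<close>

section \<open>Newman's lemma\<close>

text \<open>Well-founded induction on the peak \<open>x\<close>: local confluence joins the two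
  first steps at \<open>v\<close>, and the hypothesis at \<open>y'\<close> and then at
  \<open>z'\<close> fills in the rest of the diagram.\<close>

lemma newman_confluentp:
  assumes wf: "wfp r\<inverse>\<inverse>"
    and local: "\<And>x y z. r x y \<Longrightarrow> r x z \<Longrightarrow> \<exists>u. r\<^sup>*\<^sup>* y u \<and> r\<^sup>*\<^sup>* z u"
  shows "confluentp r"
proof (rule confluentpI)
  show "\<exists>u. r\<^sup>*\<^sup>* y u \<and> r\<^sup>*\<^sup>* z u" if "r\<^sup>*\<^sup>* x y" "r\<^sup>*\<^sup>* x z" for x y z
    using wf that
  proof (induction x arbitrary: y z rule: wfp_induct_rule)
    case (less x)
    show ?case
    proof (cases "x = y \<or> x = z")
      case True
      then show ?thesis using less.prems by blast
    next
      case False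
      then obtain y' z' where y': "r x y'" "r\<^sup>*\<^sup>* y' y" and z': "r x z'" "r\<^sup>*\<^sup>* z' z"
        using less.prems by (metis converse_rtranclpE)
      obtain v where v: "r\<^sup>*\<^sup>* y' v" "r\<^sup>*\<^sup>* z' v"
        using local[OF y'(1) z'(1)] by blast
      obtain s where s: "r\<^sup>*\<^sup>* y s" "r\<^sup>*\<^sup>* v s"
        using less.IH[of y' y v] y' v(1) by auto
      obtain t where t: "r\<^sup>*\<^sup>* s t" "r\<^sup>*\<^sup>* z t"
        using less.IH[of z' s z] z' rtranclp_trans[OF v(2) s(2)] by auto
      show ?thesis
        using rtranclp_trans[OF s(1) t(1)] t(2) by blast
    qed
  qed
qed

lemma wfp_converse_normal_form:
  assumes "wfp r\<inverse>\<inverse>"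
  shows "\<exists>y. r\<^sup>*\<^sup>* x y \<and> (\<forall>z. \<not> r y z)"
  using assms
proof (induction x rule: wfp_induct_rule)
  case (less x)
  then show ?case
    by (metis conversepI converse_rtranclp_into_rtranclp rtranclp.rtrancl_refl)
qed

text \<open>Under confluence, equivalent elements have a common reduct (Church-Rosser), and a normal
  form reduces only to itself.\<close>

lemma confluentp_normal_form_unique:
  assumes "confluentp r" "equivclp r x y" "\<And>z. \<not> r x z" "\<And>z. \<not> r y z"
  shows "x = y"
proof -
  have "(r\<^sup>*\<^sup>* OO r\<inverse>\<inverse>\<^sup>*\<^sup>*) x y"
    using assms(1,2) semiconfluentp_equivclp confluentp_imp_semiconfluentp by metis
  then obtain u where "r\<^sup>*\<^sup>* x u" "r\<^sup>*\<^sup>* y u"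
    unfolding rtranclp_conversep by blast
  then show ?thesis
    using assms(3,4) by (metis converse_rtranclpE)
qed

section \<open>Termination\<close>

text \<open>Up to an additive constant this is \<open>p\<close> times the squared distance from
  \<open>c\<close> to the point with coordinates \<open>-j/p\<close>. Each step reflects
  \<open>c\<close> towards that point.\<close>

definition core_energy :: "nat \<Rightarrow> (nat \<Rightarrow> int) \<Rightarrow> int" where
  "core_energy p c = (\<Sum>j = 0..<p. int p * (c j)\<^sup>2 + 2 * int j * c j)"

lemma core_energy_lower_bound: "- (int p * int p) \<le> core_energy p c"
proof -
  have "- int p \<le> int p * (c j)\<^sup>2 + 2 * int j * c j" if "j < p" for j
  proof -
    \<comment> \<open>Expanded, the right-hand side is exactly the summand plus
      \<open>p\<close>.\<close>
    have "0 \<le> int j * (c j + 1)\<^sup>2 + (int p - int j) * ((c j)\<^sup>2 + 1)"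
      using that by (intro add_nonneg_nonneg mult_nonneg_nonneg) auto
    then show ?thesis
      by (simp add: power2_eq_square algebra_simps)
  qed
  then have "(\<Sum>j = 0..<p. - int p) \<le> core_energy p c"
    unfolding core_energy_def by (intro sum_mono) auto
  then show ?thesis by simp
qed

lemma sum_diff_two_points:
  fixes f g :: "'a \<Rightarrow> 'b::ab_group_add"
  assumes "finite A" "a \<in> A" "b \<in> A" "a \<noteq> b"
    and eq: "\<And>x. x \<noteq> a \<Longrightarrow> x \<noteq> b \<Longrightarrow> f x = g x"
  shows "sum f A - sum g A = (f a - g a) + (f b - g b)"
proof -
  have "(\<Sum>x\<in>A. f x - g x) = (\<Sum>x\<in>{a, b}. f x - g x)"
    using assms by (intro sum.mono_neutral_right) auto
  then show ?thesis
    using \<open>a \<noteq> b\<close> by (simp add: sum_subtractf)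
qed

text \<open>The energy drops by twice the gap across the interchange:
  \<open>c j - c (j - 1)\<close>, or \<open>c 0 - c (p - 1) - 1\<close> for \<open>j = 0\<close>.
  Both are positive because \<open>w \<ge> 1\<close> and 0-allowedness is strict.\<close>

lemma core_energy_sc_less:
  assumes "2 \<le> p" "1 \<le> w" "j < p" "j_allowed p w j c"
  shows "core_energy p (sc p j c) < core_energy p c"
proof (cases "j = 0")
  case True
  let ?d = "c 0 - c (p - 1)"
  have d: "?d > 1" using assms True by (auto simp: j_allowed_def)
  have "core_energy p (sc p j c) - core_energy p c =
    (int p * (c (p - 1) + 1)\<^sup>2 - int p * (c 0)\<^sup>2)
    + ((int p * (c 0 - 1)\<^sup>2 + 2 * (int p - 1) * (c 0 - 1))
       - (int p * (c (p - 1))\<^sup>2 + 2 * (int p - 1) * c (p - 1)))"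
    using assms(1) True unfolding core_energy_def
    by (subst sum_diff_two_points[of _ 0 "p - 1"]) (auto simp: sc_def of_nat_diff)
  also have "\<dots> = - 2 * (?d - 1)"
    by (simp add: power2_eq_square algebra_simps)
  finally show ?thesis using d by simp
next
  case False
  let ?d = "c j - c (j - 1)"
  have d: "?d > 0" using assms False by (auto simp: j_allowed_def)
  have "core_energy p (sc p j c) - core_energy p c =
    ((int p * (c j)\<^sup>2 + 2 * (int j - 1) * c j)
       - (int p * (c (j - 1))\<^sup>2 + 2 * (int j - 1) * c (j - 1)))
    + ((int p * (c (j - 1))\<^sup>2 + 2 * int j * c (j - 1))
       - (int p * (c j)\<^sup>2 + 2 * int j * c j))"
    using assms(1,3) False unfolding core_energy_def
    by (subst sum_diff_two_points[of _ "j - 1" j]) (auto simp: sc_def of_nat_diff)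
  also have "\<dots> = - 2 * ?d"
    by (simp add: algebra_simps)
  finally show ?thesis using d by simp
qed

lemma wfp_scopes_step:
  assumes "2 \<le> p" "1 \<le> w"
  shows "wfp (scopes_step p w)\<inverse>\<inverse>"
proof (rule wfp_if_convertible_to_nat)
  fix d c assume "(scopes_step p w)\<inverse>\<inverse> d c"
  then have "core_energy p d < core_energy p c"
    using core_energy_sc_less[OF assms] by (auto simp: scopes_step_def)
  \<comment> \<open>The shift makes both energies nonnegative, so \<open>nat\<close> keeps the
    inequality strict.\<close>
  then show "nat (core_energy p d + int p * int p) < nat (core_energy p c + int p * int p)"
    using core_energy_lower_bound[of p d] by simp
qed

section \<open>Confluence\<close>

text \<open>Non-adjacent steps touch disjoint coordinates. Adjacent ones act on three consecutive
  values whose two gaps are at least \<open>w\<close>; the outer gap is then at least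
  \<open>2 * w\<close>, so every interchange in both reversals of the triple is allowed.\<close>

lemma sc_commute_or_braid:
  assumes p: "2 \<le> p" and w: "1 \<le> w" and ij: "i < j" "j < p"
    and ai: "j_allowed p w i c" and aj: "j_allowed p w j c"
  shows "(j_allowed p w j (sc p i c) \<and> j_allowed p w i (sc p j c) \<and>
            sc p j (sc p i c) = sc p i (sc p j c)) \<or>
         (j_allowed p w j (sc p i c) \<and> j_allowed p w i (sc p j (sc p i c)) \<and>
            j_allowed p w i (sc p j c) \<and> j_allowed p w j (sc p i (sc p j c)) \<and>
            sc p i (sc p j (sc p i c)) = sc p j (sc p i (sc p j c)))"
proof -
  \<comment> \<open>Adjacency is cyclic: \<open>wrap\<close> is the triple at \<open>p - 2\<close>,
    \<open>p - 1\<close>, \<open>0\<close>, and it also absorbs \<open>p = 2\<close>.\<close>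
  consider (wrap) "i = 0" "j = p - 1" | (adj0) "i = 0" "j = 1" "j < p - 1"
    | (far0) "i = 0" "1 < j" "j < p - 1" | (adj) "0 < i" "j = Suc i" | (far) "0 < i" "Suc i < j"
    using ij by linarith
  then show ?thesis
  proof cases
    case wrap
    \<comment> \<open>For \<open>p = 2\<close> the two conditions would make both
      \<open>c 0 - c 1\<close> and its negative positive.\<close>
    have "p \<noteq> 2" using ai aj w wrap by (auto simp: j_allowed_def)
    then have "p = Suc (Suc (Suc (p - 3)))"
      using p by linarith
    then obtain q where "p = Suc (Suc (Suc q))" ..
    then show ?thesis
      using ai aj w wrap by (intro disjI2) (auto simp: j_allowed_def sc_def fun_eq_iff)
  next
    case adj0
    then show ?thesis
      using ai aj w by (intro disjI2) (auto simp: j_allowed_def sc_def fun_eq_iff)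
  next
    case far0
    then show ?thesis
      using ai aj w by (intro disjI1) (auto simp: j_allowed_def sc_def fun_eq_iff)
  next
    case adj
    then show ?thesis
      using ai aj w by (intro disjI2) (auto simp: j_allowed_def sc_def fun_eq_iff)
  next
    case far
    then show ?thesis
      using ai aj w by (intro disjI1) (auto simp: j_allowed_def sc_def fun_eq_iff)
  qed
qed

lemma confluentp_scopes_step:
  assumes p: "2 \<le> p" and w: "1 \<le> w"
  shows "confluentp (scopes_step p w)"
proof (rule newman_confluentp[OF wfp_scopes_step[OF assms]])
  let ?r = "scopes_step p w"
  have step: "?r c (sc p j c)" if "c \<in> core_vectors p" "j < p" "j_allowed p w j c" for c j
    using that by (auto simp: scopes_step_def)
  \<comment> \<open>By symmetry it suffices to treat \<open>i < j\<close>; equal indices give the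
    same successor.\<close>
  have join: "\<exists>u. ?r\<^sup>*\<^sup>* (sc p i c) u \<and> ?r\<^sup>*\<^sup>* (sc p j c) u"
    if c: "c \<in> core_vectors p" and ij: "i < j" "j < p"
      and al: "j_allowed p w i c" "j_allowed p w j c" for c i j
  proof -
    have i: "i < p" using ij by simp
    note core = c sc_in_core_vectors[OF p c i] sc_in_core_vectors[OF p c ij(2)]
    from sc_commute_or_braid[OF p w ij al] show ?thesis
    proof (elim disjE conjE)
      assume *: "j_allowed p w j (sc p i c)" "j_allowed p w i (sc p j c)"
        "sc p j (sc p i c) = sc p i (sc p j c)"
      have "?r (sc p i c) (sc p j (sc p i c))" "?r (sc p j c) (sc p i (sc p j c))"
        by (intro step core i ij *)+
      then show ?thesis using *(3) by (metis r_into_rtranclp)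
    next
      assume *: "j_allowed p w j (sc p i c)" "j_allowed p w i (sc p j (sc p i c))"
        "j_allowed p w i (sc p j c)" "j_allowed p w j (sc p i (sc p j c))"
        "sc p i (sc p j (sc p i c)) = sc p j (sc p i (sc p j c))"
      have "?r (sc p i c) (sc p j (sc p i c))" "?r (sc p j c) (sc p i (sc p j c))"
        "?r (sc p j (sc p i c)) (sc p i (sc p j (sc p i c)))"
        "?r (sc p i (sc p j c)) (sc p j (sc p i (sc p j c)))"
        by (intro step core sc_in_core_vectors[OF p] i ij *(1-4))+
      then show ?thesis
        using *(5) by (metis r_into_rtranclp rtranclp.rtrancl_into_rtrancl)
    qed
  qed
  fix x y z assume xy: "?r x y" and xz: "?r x z"
  then obtain i j where ij: "x \<in> core_vectors p" "i < p" "j < p" "j_allowed p w i x"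
    "j_allowed p w j x" "y = sc p i x" "z = sc p j x"
    by (auto simp: scopes_step_def)
  consider "i < j" | "j < i" | "i = j" by linarith
  then show "\<exists>u. ?r\<^sup>*\<^sup>* y u \<and> ?r\<^sup>*\<^sup>* z u"
    using join[of x i j] join[of x j i] ij by cases blast+
qed

section \<open>Scopes families\<close>

lemma ancestors_iff_normal_form:
  "c \<in> ancestors p w \<longleftrightarrow> c \<in> core_vectors p \<and> (\<forall>d. \<not> scopes_step p w c d)"
  unfolding ancestors_def allowed_def scopes_step_def by blast

lemma scopes_step_rtranclp_core_vectors:
  assumes "2 \<le> p" "(scopes_step p w)\<^sup>*\<^sup>* c d" "c \<in> core_vectors p"
  shows "d \<in> core_vectors p"
  using assms(2,3)
  by induction (auto simp: scopes_step_def sc_in_core_vectors[OF assms(1)])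

text \<open>Termination supplies an ancestor in the family, confluence its uniqueness.\<close>

lemma scopes_family_unique_ancestor:
  assumes p: "2 \<le> p" and w: "1 \<le> w" and F: "F \<in> scopes_families p w"
  shows "\<exists>!c. c \<in> F \<and> c \<in> ancestors p w"
proof -
  obtain x where x: "x \<in> core_vectors p" and F_eq: "F = scopes_rel p w `` {x}"
    using F by (auto simp: scopes_families_def quotient_def)
  obtain y where y: "(scopes_step p w)\<^sup>*\<^sup>* x y" "\<forall>z. \<not> scopes_step p w y z"
    using wfp_converse_normal_form[OF wfp_scopes_step[OF p w]] by blast
  have y_core: "y \<in> core_vectors p"
    using scopes_step_rtranclp_core_vectors[OF p y(1) x] .
  have "equivclp (scopes_step p w) x y"
    by (rule rtranlcp_le_equivclp[THEN predicate2D, OF y(1)])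
  then have "y \<in> F"
    using x y_core by (simp add: F_eq scopes_rel_def)
  moreover have "y \<in> ancestors p w"
    using y(2) y_core by (simp add: ancestors_iff_normal_form)
  moreover have "a = b" if "a \<in> F \<and> a \<in> ancestors p w" "b \<in> F \<and> b \<in> ancestors p w" for a b
  proof (rule confluentp_normal_form_unique[OF confluentp_scopes_step[OF p w]])
    have "equivclp (scopes_step p w) x a" "equivclp (scopes_step p w) x b"
      using that by (auto simp: F_eq scopes_rel_def)
    then show "equivclp (scopes_step p w) a b"
      by (blast intro: equivclp_sym equivclp_trans)
  qed (use that in \<open>auto simp: ancestors_iff_normal_form\<close>)
  ultimately show ?thesis by blast
qed

section \<open>Parametrization of the ancestors\<close>

text \<open>Summation by parts: \<open>f i\<close> occurs in the partial sums for
  \<open>j = i, ..., n - 1\<close>, hence \<open>n - i\<close> times.\<close>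

lemma sum_partial_sums:
  fixes f :: "nat \<Rightarrow> int"
  shows "(\<Sum>j = 0..<n. \<Sum>i = 1..j. f i) = int n * (\<Sum>i = 1..n. f i) - (\<Sum>i = 1..n. int i * f i)"
  by (induction n) (auto simp: algebra_simps)

lemma double_sum_atLeast0LessThan: "2 * (\<Sum>j = 0..<n. int j) = int n * (int n - 1)"
  by (induction n) (auto simp: algebra_simps)

lemma double_triangular_div:
  fixes a b :: int
  shows "2 * (a * b * (b + 1) div 2) = a * b * (b + 1)"
proof -
  have "even (a * b * (b + 1))" by auto
  then show ?thesis by simp
qed

lemma c_of_in_ancestors:
  assumes p: "2 \<le> p"
    and j0: "[int j0 = (int w - 1) * int p * (int p + 1) div 2] (mod int p)"
    and k: "k \<in> E_set p w j0"
  shows "c_of p w k \<in> ancestors p w"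
proof -
  define B where "B = (int w - 1) * int p * (int p + 1) div 2"
  define W where "W = (\<Sum>i = 1..p. int i * int (k i))"
  have B: "2 * B = (int w - 1) * int p * (int p + 1)"
    unfolding B_def by (rule double_triangular_div)
  have W: "int (\<Sum>i = 1..p. i * k i) = W" by (simp add: W_def)
  have S: "(\<Sum>i = 1..p. int (k i)) = int p * int w - (int p - 1)"
    using k by (simp add: E_set_def)
  have dvd: "int p dvd B - W"
    using c0_division_exact[OF j0 k] unfolding B_def W .
  then have c0: "int p * (c0_of p w k - 1) = B - W"
    unfolding c0_of_def W B_def[symmetric] by simp
  have val: "c_of p w k j = c0_of p w k + int j * (int w - 1) - (\<Sum>i = 1..j. int (k i))"
    if "j < p" for j
    using that by (simp add: c_of_def)
  have "(\<Sum>j = 0..<p. c_of p w k j)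
      = int p * c0_of p w k + (\<Sum>j = 0..<p. int j) * (int w - 1)
        - (\<Sum>j = 0..<p. \<Sum>i = 1..j. int (k i))"
    by (simp add: val sum.distrib sum_subtractf sum_distrib_right)
  also have "\<dots> = int p * c0_of p w k + (\<Sum>j = 0..<p. int j) * (int w - 1)
        - (int p * (int p * int w - (int p - 1)) - W)"
    by (simp only: sum_partial_sums S W_def)
  \<comment> \<open>Doubling clears the division by 2 in \<open>B\<close> and in the triangular
    sum.\<close>
  finally have "2 * (\<Sum>j = 0..<p. c_of p w k j)
      = 2 * (int p * c0_of p w k) + (2 * (\<Sum>j = 0..<p. int j)) * (int w - 1)
        - 2 * (int p * (int p * int w - (int p - 1)) - W)"
    by (simp add: algebra_simps)
  also have "\<dots> = 2 * (B - W + int p) + (int p * (int p - 1)) * (int w - 1)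
        - 2 * (int p * (int p * int w - (int p - 1)) - W)"
    unfolding double_sum_atLeast0LessThan using c0 by (simp add: algebra_simps)
  also have "\<dots> = 0"
    using B by (simp add: algebra_simps)
  finally have "c_of p w k \<in> core_vectors p"
    by (simp add: core_vectors_def c_of_def)
  moreover have "\<not> j_allowed p w j (c_of p w k)" if "j < p" for j
  proof (cases j)
    case 0
    \<comment> \<open>\<open>k p\<close> enters no coordinate beyond \<open>c0_of\<close>; the
      prescribed total recovers it as the slack of the wrap-around difference.\<close>
    have "(\<Sum>i = 1..p. int (k i)) = (\<Sum>i = 1..p - 1. int (k i)) + int (k p)"
      using p by (cases p) auto
    then have "c_of p w k 0 - c_of p w k (p - 1) = int w - int (k p)"
      using S p by (simp add: val of_nat_diff algebra_simps)
    then show ?thesis using 0 by (simp add: j_allowed_def)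
  next
    case (Suc i)
    then have "c_of p w k j - c_of p w k i = int w - 1 - int (k j)"
      using that by (simp add: val algebra_simps)
    then show ?thesis using Suc by (simp add: j_allowed_def)
  qed
  ultimately show ?thesis
    by (auto simp: ancestors_def allowed_def)
qed

lemma ancestor_is_c_of:
  assumes p: "2 \<le> p"
    and j0: "[int j0 = (int w - 1) * int p * (int p + 1) div 2] (mod int p)"
    and c: "c \<in> ancestors p w"
  shows "\<exists>k \<in> E_set p w j0. c = c_of p w k"
proof -
  define B where "B = (int w - 1) * int p * (int p + 1) div 2"
  have B: "2 * B = (int w - 1) * int p * (int p + 1)"
    unfolding B_def by (rule double_triangular_div)
  \<comment> \<open>Solving the formula for \<open>c_of\<close> gives these slacks. Index
    \<open>p\<close> has \<open>w\<close> instead of \<open>w - 1\<close> because 0-allowedness is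
    strict. As no \<open>j\<close> is allowed, \<open>nat\<close> truncates nothing.\<close>
  define k where "k = (\<lambda>i\<in>{1..p}. nat (if i = p then int w - (c 0 - c (p - 1))
    else int w - 1 - (c i - c (i - 1))))"
  have ext: "c \<in> extensional {0..<p}" and sum0: "(\<Sum>j = 0..<p. c j) = 0"
    using c by (auto simp: ancestors_def core_vectors_def PiE_def)
  have not_allowed: "\<not> j_allowed p w j c" if "j < p" for j
    using c that by (auto simp: ancestors_def allowed_def)
  have k_less: "int (k i) = int w - 1 - (c i - c (i - 1))" if "1 \<le> i" "i < p" for i
    using not_allowed[of i] that by (simp add: k_def j_allowed_def)
  have k_p: "int (k p) = int w - (c 0 - c (p - 1))"
    using not_allowed[of 0] p by (simp add: k_def j_allowed_def)
  have partial: "(\<Sum>i = 1..j. int (k i)) = int j * (int w - 1) - (c j - c 0)" if "j < p" for j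
    using that
  proof (induction j)
    case (Suc j)
    then show ?case using k_less[of "Suc j"] by (simp add: algebra_simps)
  qed simp
  have "(\<Sum>i = 1..p. int (k i)) = (\<Sum>i = 1..p - 1. int (k i)) + int (k p)"
    using p by (cases p) auto
  then have S: "(\<Sum>i = 1..p. int (k i)) = int p * int w - (int p - 1)"
    using partial[of "p - 1"] k_p p by (simp add: of_nat_diff algebra_simps)
  define W where "W = (\<Sum>i = 1..p. int i * int (k i))"
  have W: "int (\<Sum>i = 1..p. i * k i) = W" by (simp add: W_def)
  \<comment> \<open>The coordinates sum to zero, so only the \<open>p\<close> copies of
    \<open>c 0\<close> remain.\<close>
  have "(\<Sum>j = 0..<p. \<Sum>i = 1..j. int (k i)) = (\<Sum>j = 0..<p. int j) * (int w - 1) + int p * c 0"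
    using sum0 by (simp add: partial sum.distrib sum_subtractf sum_distrib_right del: One_nat_def)
  then have "W = int p * (int p * int w - (int p - 1))
      - ((\<Sum>j = 0..<p. int j) * (int w - 1) + int p * c 0)"
    using sum_partial_sums[of "\<lambda>i. int (k i)" p] by (simp only: S W_def)
  then have "2 * W = 2 * (int p * (int p * int w - (int p - 1)))
      - ((2 * (\<Sum>j = 0..<p. int j)) * (int w - 1) + 2 * (int p * c 0))"
    by (simp add: algebra_simps)
  also have "\<dots> = 2 * (B - int p * (c 0 - 1))"
    unfolding double_sum_atLeast0LessThan using B by (simp add: algebra_simps)
  \<comment> \<open>This one identity yields both the congruence defining \<open>E_set\<close> and
    \<open>c0_of p w k = c 0\<close>.\<close>
  finally have BW: "B - W = int p * (c 0 - 1)" by simp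
  have "[W = B] (mod int p)"
    using BW by (metis cong_iff_dvd_diff cong_sym dvd_triv_left)
  then have "[int (\<Sum>i = 1..p. i * k i) = int j0] (mod int p)"
    using j0 unfolding W B_def by (meson cong_sym cong_trans)
  then have "[(\<Sum>i = 1..p. i * k i) = j0] (mod p)"
    by (simp only: cong_int_iff)
  moreover have "k \<in> {1..p} \<rightarrow>\<^sub>E UNIV" by (simp add: k_def)
  ultimately have "k \<in> E_set p w j0"
    using S by (simp add: E_set_def)
  moreover have "c0_of p w k = c 0"
    unfolding c0_of_def W B_def[symmetric] BW using p by simp
  then have "c = c_of p w k"
    using ext by (intro extensionalityI[of _ "{0..<p}"]) (auto simp: c_of_def partial simp del: One_nat_def)
  ultimately show ?thesis by blast
qed

theorem theorem4p10:
  fixes p w j0 :: nat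
  assumes "prime p"
    and "w \<ge> 1"
    and "j0 \<in> {0..p - 1}"
    and "[int j0 = (int w - 1) * int p * (int p + 1) div 2] (mod int p)"
  shows "{c_of p w k | k. k \<in> E_set p w j0} = ancestors p w \<and>
    (\<forall>F \<in> scopes_families p w. \<exists>!c. c \<in> F \<and> c \<in> {c_of p w k | k. k \<in> E_set p w j0})"
proof -
  have p: "2 \<le> p" using assms(1) by (rule prime_ge_2_nat)
  have "{c_of p w k | k. k \<in> E_set p w j0} = ancestors p w"
    using c_of_in_ancestors[OF p assms(4)] ancestor_is_c_of[OF p assms(4)] by blast
  then show ?thesis
    using scopes_family_unique_ancestor[OF p assms(2)] by simp
qed

end
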